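(* Let $d\in\mathbb{N}^{+}\cup\{\infty\}$, $\alpha\in\mathrm{DC}^d$, $\mathbf{m}\in\mathbb{Z}^d_*$, and $v(x)=\mathrm{e}^{\mathrm{i}\langle\mathbf{m},x\rangle}$. Then there exists $E\in(-2,2)$ such that, provided $\lambda\in\mathbb{R}\setminus\{0\}$ and $|\lambda|$ is sufficiently small, the cocycle $(\alpha,S_{E,\lambda v})$ is reducible to $\Big(\alpha,\begin{pmatrix}1&\zeta\\0&1\end{pmatrix}\Big)$ for some $\zeta\neq0$.
   Context: Torus: $\mathbb{T}=\mathbb{R}/2\pi\mathbb{Z}$, $2\mathbb{T}^d=(\mathbb{R}/4\pi\mathbb{Z})^d$, $d\in\mathbb{N}^+\cup\{\infty\}$; coordinates are indexed by integers $1\le j\le d$ (all $j\ge1$ if $d=\infty$), $\langle j\rangle=\max\{1,j\}$. Fix $\eta>0$; for an integer vector $\mathbf{k}$, $|\mathbf{k}|_\eta=\sum_j\langle j\rangle^\eta|\mathbf{k}_j|$, and $\mathbb{Z}^d_*=\{\mathbf{k}\in\mathbb{Z}^d:0<|\mathbf{k}|_\eta<\infty\}$. For $\gamma\in(0,1)$ and fixed $\tau>1$, $\mathrm{DC}^d_{\gamma,\tau}$ is the set of $\alpha\in[1,2]^d$ with $\inf_{n\in\mathbb{Z}}|\langle\mathbf{k},\alpha\rangle-2\pi n|\ge\gamma\prod_j\frac1{1+\langle j\rangle^\tau|\mathbf{k}_j|^\tau}$ for all $\mathbf{k}\in\mathbb{Z}^d_*$; $\mathrm{DC}^d=\bigcup_{\gamma>0}\mathrm{DC}^d_{\gamma,\tau}$.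 $S_{E,\lambda v}(x)=\begin{pmatrix}E-\lambda v(x)&-1\\1&0\end{pmatrix}$. $C^\omega(2\mathbb{T}^d,\mathrm{SL}(2,\mathbb{C}))$ denotes the $\mathrm{SL}(2,\mathbb{C})$-valued functions $B(x)=\sum_{\mathbf{k}}\widehat B_{\mathbf{k}}\mathrm{e}^{\mathrm{i}\langle\mathbf{k},x\rangle/2}$ (sum over finitely supported $\mathbf{k}\in\mathbb{Z}^d$) with $\sum_{\mathbf{k}}|\widehat B_{\mathbf{k}}|\mathrm{e}^{h|\mathbf{k}|_\eta/2}<\infty$ for some $h>0$. $(\alpha,A)$ is reducible to $(\alpha,A')$, $A'\in\mathrm{SL}(2,\mathbb{C})$ constant, if there is $B\in C^\omega(2\mathbb{T}^d,\mathrm{SL}(2,\mathbb{C}))$ with $B(x+\alpha)^{-1}A(x)B(x)=A'$ (with $\alpha$ regarded as a vector in $[1,2]^d\subset\mathbb{R}^d$). *)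

theory Defs
  imports "HOL-Analysis.Analysis" "HOL-Library.Extended_Nat"
begin

text \<open>
  The dimension is \<open>d :: enat\<close>, with \<open>\<infinity>\<close> allowed.  Vectors in \<open>\<real>\<^sup>d\<close> and \<open>\<int>\<^sup>d\<close> are functions
  on \<open>nat\<close> that vanish off the coordinates \<open>{j. 1 \<le> j \<le> d}\<close>, so that equal vectors are equal
  functions and sums over integer vectors count each vector once.
\<close>

definition coords :: "enat \<Rightarrow> nat set" where
  "coords d = {j. 1 \<le> j \<and> enat j \<le> d}"

definition real_vectors :: "enat \<Rightarrow> (nat \<Rightarrow> real) set" where
  "real_vectors d = {x. \<forall>j. j \<notin> coords d \<longrightarrow> x j = 0}"

definition int_vectors :: "enat \<Rightarrow> (nat \<Rightarrow> int) set" where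
  "int_vectors d = {k. \<forall>j. j \<notin> coords d \<longrightarrow> k j = 0}"

definition fin_int_vectors :: "enat \<Rightarrow> (nat \<Rightarrow> int) set" where
  "fin_int_vectors d = {k \<in> int_vectors d. finite {j. k j \<noteq> 0}}"

definition bracket :: "nat \<Rightarrow> real" where
  "bracket j = max 1 (real j)"

text \<open>\<open>|k|\<^sub>\<eta>\<close>; the value is \<open>\<infinity>\<close> exactly if \<open>k\<close> has infinite support.\<close>

definition eta_norm :: "real \<Rightarrow> (nat \<Rightarrow> int) \<Rightarrow> ennreal" where
  "eta_norm \<eta> k = (\<Sum>j. ennreal (bracket j powr \<eta> * \<bar>real_of_int (k j)\<bar>))"

definition int_vectors_star :: "real \<Rightarrow> enat \<Rightarrow> (nat \<Rightarrow> int) set" where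
  "int_vectors_star \<eta> d = {k \<in> int_vectors d. 0 < eta_norm \<eta> k \<and> eta_norm \<eta> k < \<infinity>}"

text \<open>\<open>\<langle>k, x\<rangle>\<close>, meaningful only for finitely supported \<open>k\<close>.\<close>

definition pairing :: "(nat \<Rightarrow> int) \<Rightarrow> (nat \<Rightarrow> real) \<Rightarrow> real" where
  "pairing k x = (\<Sum>j | k j \<noteq> 0. real_of_int (k j) * x j)"

text \<open>The factors of the product over \<open>j\<close> with \<open>k j = 0\<close> are all 1 and are left out.\<close>

definition DC_const :: "real \<Rightarrow> real \<Rightarrow> enat \<Rightarrow> real \<Rightarrow> (nat \<Rightarrow> real) set" where
  "DC_const \<eta> \<tau> d \<gamma> = {\<alpha> \<in> real_vectors d. (\<forall>j\<in>coords d. \<alpha> j \<in> {1..2}) \<and>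
     (\<forall>k\<in>int_vectors_star \<eta> d.
        (INF n::int. \<bar>pairing k \<alpha> - 2 * pi * real_of_int n\<bar>)
          \<ge> \<gamma> * (\<Prod>j | k j \<noteq> 0. 1 / (1 + bracket j powr \<tau> * \<bar>real_of_int (k j)\<bar> powr \<tau>)))}"

definition DC :: "real \<Rightarrow> real \<Rightarrow> enat \<Rightarrow> (nat \<Rightarrow> real) set" where
  "DC \<eta> \<tau> d = (\<Union>\<gamma>\<in>{0<..<1}. DC_const \<eta> \<tau> d \<gamma>)"

definition schroedinger ::
    "real \<Rightarrow> real \<Rightarrow> ((nat \<Rightarrow> real) \<Rightarrow> complex) \<Rightarrow> (nat \<Rightarrow> real) \<Rightarrow> complex^2^2" where
  "schroedinger E \<mu> v x =
     vector [vector [complex_of_real E - complex_of_real \<mu> * v x, -1], vector [1, 0]]"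

text \<open>
  \<open>C\<^sup>\<omega>(2\<T>\<^sup>d, SL(2,\<complex>))\<close>.  Functions on a torus are represented by their lifts to \<open>\<real>\<^sup>d\<close>; the
  \<open>4\<pi>\<close>-periodicity in each coordinate is a consequence of the Fourier expansion in
  \<open>e\<^bsup>i\<langle>k,x\<rangle>/2\<^esup>\<close>.  Values off \<open>real_vectors d\<close> are irrelevant.
\<close>

definition analytic_SL2 :: "real \<Rightarrow> enat \<Rightarrow> ((nat \<Rightarrow> real) \<Rightarrow> complex^2^2) set" where
  "analytic_SL2 \<eta> d = {B.
     (\<forall>x\<in>real_vectors d. det (B x) = 1) \<and>
     (\<exists>(Bhat :: (nat \<Rightarrow> int) \<Rightarrow> complex^2^2) (h :: real). h > 0 \<and>
        (\<lambda>k. norm (Bhat k) * exp (h * enn2real (eta_norm \<eta> k) / 2)) summable_on fin_int_vectors d \<and>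
        (\<forall>x\<in>real_vectors d.
           ((\<lambda>k. \<chi> i j. cis (pairing k x / 2) * Bhat k $ i $ j) has_sum B x) (fin_int_vectors d)))}"

definition reducible_to ::
    "real \<Rightarrow> enat \<Rightarrow> (nat \<Rightarrow> real) \<Rightarrow> ((nat \<Rightarrow> real) \<Rightarrow> complex^2^2) \<Rightarrow> complex^2^2 \<Rightarrow> bool" where
  "reducible_to \<eta> d \<alpha> A A' \<longleftrightarrow> det A' = 1 \<and>
     (\<exists>B\<in>analytic_SL2 \<eta> d. \<forall>x\<in>real_vectors d.
        matrix_inv (B (\<lambda>j. x j + \<alpha> j)) ** A x ** B x = A')"

end

theory Submission
  imports Defs
begin

text \<open>
  Put \<open>\<omega> = \<langle>m, \<alpha>\<rangle>\<close> and take the resonant energy \<open>E = 2 cos (\<omega>/2)\<close>.  As \<open>v\<close> has a single, positive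
  frequency, the Schroedinger equation can be solved by one-sided series in
  \<open>e\<^bsup>i(n - 1/2)\<theta>\<^esup>\<close>, \<open>\<theta> = \<langle>m, x\<rangle>\<close>: its symbol
  \<open>E - 2 cos ((n - 1/2)\<omega>) = 4 sin (n\<omega>/2) sin ((n - 1)\<omega>/2)\<close> vanishes only for \<open>n = 0\<close> and \<open>n = 1\<close>.
  Starting from \<open>n = 1\<close> one gets a genuine solution \<open>\<psi>\<close>.  Starting from \<open>n = 0\<close>, the equation at
  \<open>n = 1\<close> is obstructed, and the obstruction is removed by a multiple \<open>\<zeta> \<noteq> 0\<close> of \<open>\<psi>\<close>, which yields a
  generalized solution and hence a Jordan block.  The coefficients are
  \<open>\<mu>\<close>-powers divided by products of small divisors; for Diophantine \<open>\<omega>\<close> these products decay at most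
  exponentially, so the series converge for small \<open>\<mu>\<close>.
\<close>

subsection \<open>Products of small divisors\<close>

text \<open>Remove the maximum \<open>M\<close>: the rest lies in \<open>{1..N}\<close>, with
  \<open>N\<close> its own maximum, and \<open>M - N\<close> is at least \<open>G\<close>. Requiring
  \<open>G \<le> real i\<close> treats 0 as one more separated point, so the bound has no additive
  1.\<close>

lemma card_separated_le:
  fixes G :: real
  assumes "S \<subseteq> {1..k}" and "\<And>i. i \<in> S \<Longrightarrow> G \<le> real i"
    and "\<And>i j. i \<in> S \<Longrightarrow> j \<in> S \<Longrightarrow> j < i \<Longrightarrow> G \<le> real (i - j)"
  shows "real (card S) * G \<le> real k"
  using assms
proof (induction k arbitrary: S rule: less_induct)
  case (less k)
  have fin: "finite S" using less.prems(1) finite_subset by blast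
  show ?case
  proof (cases "S = {}")
    case False
    define M where "M = Max S"
    have M: "M \<in> S" "\<And>i. i \<in> S \<Longrightarrow> i \<le> M" using fin False by (auto simp: M_def)
    have Mk: "1 \<le> M" "M \<le> k" using M less.prems(1) by auto
    show ?thesis
    proof (cases "S = {M}")
      case True
      then show ?thesis using less.prems(2)[OF M(1)] Mk by simp
    next
      case False
      define T where "T = S - {M}"
      have T: "T \<noteq> {}" "finite T" using False M fin by (auto simp: T_def)
      define N where "N = Max T"
      have N: "N \<in> T" "\<And>i. i \<in> T \<Longrightarrow> i \<le> N" using T by (auto simp: N_def)
      have NM: "N < M" "N \<in> S" using N M(2)[of N] by (auto simp: T_def)
      have "T \<subseteq> {1..k}" using less.prems(1) by (auto simp: T_def)
      then have TN: "T \<subseteq> {1..N}" using N(2) by fastforce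
      have "real (card T) * G \<le> real N"
      proof (rule less.IH[OF _ TN])
        show "N < k" using NM Mk by simp
        show "G \<le> real i" if "i \<in> T" for i using less.prems(2) that by (simp add: T_def)
        show "G \<le> real (i - j)" if "i \<in> T" "j \<in> T" "j < i" for i j
          using less.prems(3) that by (simp add: T_def)
      qed
      moreover have "G \<le> real (M - N)" using less.prems(3) NM M by blast
      moreover have "card S = Suc (card T)"
        using M fin unfolding T_def by (metis card_Suc_Diff1)
      ultimately show ?thesis using NM Mk by (simp add: algebra_simps of_nat_diff)
    qed
  qed simp
qed

text \<open>The thresholds \<open>(1/2) ^ l\<close> decrease in \<open>l\<close>, so those above
  \<open>D\<close> form an initial segment and their number gives the dyadic size of
  \<open>D\<close>. Sizes thus become cardinalities, which can be double counted.\<close>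

lemma dyadic_lower_bound:
  fixes D :: real
  assumes "(1/2) ^ N \<le> D"
  shows "(1/2) ^ Suc (card {l \<in> {1..N}. D < (1/2) ^ l}) \<le> D"
proof (rule ccontr)
  define t where "t = card {l \<in> {1..N}. D < (1/2) ^ l}"
  assume "\<not> ?thesis"
  then have less: "D < (1/2) ^ Suc t" by (simp add: t_def)
  have mono: "D < (1/2) ^ l" if "l \<le> Suc t" for l
    using less power_decreasing[OF that, of "1/2::real"] by simp
  show False
  proof (cases "Suc t \<le> N")
    case True
    then have "{1..Suc t} \<subseteq> {l \<in> {1..N}. D < (1/2) ^ l}" using mono by auto
    then have "card {1..Suc t} \<le> t" unfolding t_def by (intro card_mono) auto
    then show False by simp
  next
    case False
    then show False using mono[of N] assms by simp
  qed
qed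

text \<open>
  The bound \<open>c / n powr s\<close> alone would only give the lower bound \<open>c ^ k / (k!) powr s\<close>.
  Subadditivity forces the indices with \<open>D j < 2 powr (-l)\<close> to be separated by about
  \<open>2 powr (l / s)\<close>, so there are at most \<open>k\<close> times a geometrically decaying factor of them below
  \<open>k\<close>, and the exponents \<open>-log 2 (D j)\<close> sum to \<open>O(k)\<close>.
\<close>

lemma prod_small_divisors_ge:
  fixes D :: "nat \<Rightarrow> real"
  assumes "c > 0" and "s > 0"
    and lower: "\<And>n. n \<ge> 1 \<Longrightarrow> c / real n powr s \<le> D n"
    and subadd: "\<And>i j. j < i \<Longrightarrow> D (i - j) \<le> D i + D j"
  shows "\<exists>K\<ge>1. \<forall>k. 1 / K ^ k \<le> (\<Prod>j=1..k. D j)"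
proof -
  \<comment> \<open>Solving \<open>c / n powr s < 2 * (1/2) ^ l\<close> for \<open>n\<close> gives
    \<open>n\<close> at least \<open>b * q ^ l\<close>. The factor 2 leaves room for the sum of two
    divisors below \<open>(1/2) ^ l\<close>.\<close>
  define q where "q = 2 powr (1/s)"
  define b where "b = (c/2) powr (1/s)"
  have q: "q > 1" unfolding q_def using \<open>s > 0\<close> by simp
  have b: "b > 0" unfolding b_def using \<open>c > 0\<close> by simp
  have gap: "b * q ^ l \<le> real n" if "n \<ge> 1" "D n < 2 * (1/2) ^ l" for n l
  proof -
    have "c / real n powr s < 2 * (1/2) ^ l" using lower[OF that(1)] that(2) by simp
    then have "c / 2 * 2 ^ l \<le> real n powr s"
      using that(1) by (simp add: field_simps power_divide)
    then have "(c / 2 * 2 ^ l) powr (1/s) \<le> (real n powr s) powr (1/s)"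
      using \<open>c > 0\<close> \<open>s > 0\<close> by (intro powr_mono2) auto
    moreover have "(c / 2 * 2 ^ l) powr (1/s) = b * q ^ l"
      using \<open>c > 0\<close> powr_mult[of "c / 2" "2 powr real l" "1/s"] unfolding b_def q_def
      by (simp add: powr_powr mult.commute flip: powr_realpow)
    moreover have "(real n powr s) powr (1/s) = real n"
      using \<open>s > 0\<close> that(1) by (simp add: powr_powr)
    ultimately show ?thesis by simp
  qed
  have count: "real (card {j \<in> {1..k}. D j < (1/2) ^ l}) \<le> real k * (1/b * (1/q) ^ l)" for k l
  proof -
    have "real (card {j \<in> {1..k}. D j < (1/2) ^ l}) * (b * q ^ l) \<le> real k"
    proof (rule card_separated_le)
      fix i assume "i \<in> {j \<in> {1..k}. D j < (1/2) ^ l}"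
      then show "b * q ^ l \<le> real i" 
        by (intro gap) (auto intro: less_le_trans[of "D i"])
    next
      fix i j assume "i \<in> {j \<in> {1..k}. D j < (1/2) ^ l}" "j \<in> {j \<in> {1..k}. D j < (1/2) ^ l}" "j < i"
      then show "b * q ^ l \<le> real (i - j)" using subadd[of j i] by (intro gap) auto
    qed auto
    then show ?thesis using b q by (simp add: field_simps)
  qed
  define M where "M = 1/b * (1 / (1 - 1/q))"
  have geom: "(\<Sum>l=1..N. 1/b * (1/q) ^ l) \<le> M" for N
  proof -
    have "(\<Sum>l=1..N. (1/q) ^ l) \<le> (\<Sum>l. (1/q) ^ l)"
      using q by (intro sum_le_suminf summable_geometric) auto
    also have "\<dots> = 1 / (1 - 1/q)" using q by (intro suminf_geometric) auto
    finally show ?thesis using b unfolding M_def sum_distrib_left[symmetric]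
      by (intro mult_left_mono) auto
  qed
  have M0: "M \<ge> 0" using b q by (simp add: M_def)
  \<comment> \<open>Factor \<open>j\<close> of the product will be at least
    \<open>(1/2) ^ Suc (t j)\<close>, and these exponents sum to at most
    \<open>k * (1 + M)\<close>.\<close>
  define K where "K = 2 powr (1 + M)"
  have pos: "D n > 0" if "n \<ge> 1" for n
    using lower[OF that] that \<open>c > 0\<close> by (smt (verit) divide_pos_pos powr_gt_zero of_nat_0_less_iff less_le_trans zero_less_one order_less_le_trans)
  show ?thesis
  proof (intro exI conjI allI)
    show "K \<ge> 1" using M0 by (simp add: K_def ge_one_powr_ge_zero)
    fix k
    \<comment> \<open>\<open>N\<close> only truncates the list of thresholds and may depend on
      \<open>k\<close>, since \<open>geom\<close> bounds the sum by \<open>M\<close> for every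
      \<open>N\<close>.\<close>
    have "\<exists>N. \<forall>j\<in>{1..k}. (1/2) ^ N \<le> D j"
    proof (induction k)
      case (Suc k)
      then obtain N where N: "\<forall>j\<in>{1..k}. (1/2) ^ N \<le> D j" by blast
      obtain N' where N': "(1/2) ^ N' < D (Suc k)"
        using real_arch_pow_inv[of "D (Suc k)" "1/2"] pos[of "Suc k"] by auto
      have le: "(1/2::real) ^ max N N' \<le> (1/2) ^ N" "(1/2::real) ^ max N N' \<le> (1/2) ^ N'"
        by (auto intro!: power_decreasing)
      then have "(1/2) ^ max N N' \<le> D j" if "j \<in> {1..Suc k}" for j
      proof (cases "j = Suc k")
        case True
        then show ?thesis using le(2) N' unfolding True by linarith
      next
        case False
        then show ?thesis using le(1) N that by (intro order.trans[OF le(1)]) auto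
      qed
      then show ?case by blast
    qed auto
    then obtain N where N: "\<And>j. j \<in> {1..k} \<Longrightarrow> (1/2) ^ N \<le> D j" by blast
    define t where "t j = card {l \<in> {1..N}. D j < (1/2) ^ l}" for j
    \<comment> \<open>Pairs \<open>(j, l)\<close> are counted by \<open>l\<close> first, so that
      \<open>count\<close> applies at each scale.\<close>
    have "(\<Sum>j=1..k. t j) = (\<Sum>j=1..k. \<Sum>l=1..N. if D j < (1/2) ^ l then 1 else 0)"
      unfolding t_def by (simp add: sum.If_cases Int_def)
    also have "\<dots> = (\<Sum>l=1..N. \<Sum>j=1..k. if D j < (1/2) ^ l then 1 else 0)" by (rule sum.swap)
    also have "\<dots> = (\<Sum>l=1..N. card {j \<in> {1..k}. D j < (1/2) ^ l})"
      by (simp add: sum.If_cases Int_def)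
    finally have "real (\<Sum>j=1..k. t j) = (\<Sum>l=1..N. real (card {j \<in> {1..k}. D j < (1/2) ^ l}))"
      by simp
    also have "\<dots> \<le> (\<Sum>l=1..N. real k * (1/b * (1/q) ^ l))" by (intro sum_mono count)
    also have "\<dots> \<le> real k * M" using geom[of N] unfolding sum_distrib_left[symmetric]
      by (intro mult_left_mono) auto
    finally have t: "real (\<Sum>j=1..k. t j) \<le> real k * M" .
    have "K ^ k = 2 powr (real k * (1 + M))"
      by (simp add: K_def mult.commute powr_powr flip: powr_realpow)
    also have "\<dots> \<ge> 2 powr real (\<Sum>j=1..k. Suc (t j))"
      using t by (intro powr_mono) (auto simp: sum.distrib algebra_simps)
    finally have "2 ^ (\<Sum>j=1..k. Suc (t j)) \<le> K ^ k" by (subst (asm) powr_realpow) auto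
    then have "1 / K ^ k \<le> (1/2) ^ (\<Sum>j=1..k. Suc (t j))"
      by (simp add: power_divide frac_le)
    also have "\<dots> = (\<Prod>j=1..k. (1/2) ^ Suc (t j))" by (rule power_sum)
    also have "\<dots> \<le> (\<Prod>j=1..k. D j)"
      using N unfolding t_def by (intro prod_mono conjI dyadic_lower_bound) auto
    finally show "1 / K ^ k \<le> (\<Prod>j=1..k. D j)" .
  qed
qed

subsection \<open>Integer vectors and the Diophantine condition\<close>

text \<open>Take \<open>l\<close> nearest to \<open>y / pi\<close>. The remainder \<open>x\<close>
  has modulus at most \<open>pi / 2 < 2\<close>, where the cubic Taylor error is at most
  \<open>4/6 * \<bar>x\<bar>\<close>; a third of \<open>\<bar>x\<bar>\<close> is left.\<close>

lemma abs_sin_ge_dist_multiple_pi: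
  fixes y :: real
  obtains l :: int where "\<bar>y - of_int l * pi\<bar> / 3 \<le> \<bar>sin y\<bar>"
proof
  define l where "l = round (y / pi)"
  define x where "x = y - of_int l * pi"
  have "\<bar>of_int l - y / pi\<bar> \<le> 1/2" unfolding l_def by (rule of_int_round_abs_le)
  moreover have "\<bar>x\<bar> = pi * \<bar>of_int l - y / pi\<bar>"
  proof -
    have "x = pi * (y / pi - of_int l)" by (simp add: x_def algebra_simps)
    then show ?thesis by (simp add: abs_mult abs_minus_commute)
  qed
  ultimately have "\<bar>x\<bar> \<le> pi * (1/2)" by (simp only:) (intro mult_left_mono, auto)
  then have x: "\<bar>x\<bar> \<le> 2" using pi_less_4 by simp
  have "\<bar>sin x - x\<bar> \<le> \<bar>x\<bar> ^ 3 / 6"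
    using Maclaurin_sin_bound[of x 3]
    by (simp add: eval_nat_numeral sin_coeff_def fact_numeral field_simps)
  moreover have "\<bar>x\<bar> ^ 3 \<le> 4 * \<bar>x\<bar>"
    using mult_right_mono[OF power_mono[OF x abs_ge_zero, of 2] abs_ge_zero[of x]]
    by (simp add: eval_nat_numeral)
  ultimately have "\<bar>x\<bar> / 3 \<le> \<bar>sin x\<bar>" by linarith
  moreover have "\<bar>sin x\<bar> = \<bar>sin y\<bar>"
  proof -
    have s: "sin (of_int l * pi) = 0" by (auto simp: sin_zero_iff_int2)
    then have "\<bar>cos (of_int l * pi)\<bar> = 1"
      using sin_cos_squared_add[of "of_int l * pi"] by (simp add: abs_square_eq_1)
    then show ?thesis using s by (simp add: x_def sin_diff abs_mult)
  qed
  ultimately show "\<bar>y - of_int l * pi\<bar> / 3 \<le> \<bar>sin y\<bar>" by (simp add: x_def)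
qed

lemma abs_sin_subadditive:
  fixes a b :: real
  shows "\<bar>2 * sin (a - b)\<bar> \<le> \<bar>2 * sin a\<bar> + \<bar>2 * sin b\<bar>"
proof -
  have "\<bar>sin (a - b)\<bar> \<le> \<bar>sin a * cos b\<bar> + \<bar>cos a * sin b\<bar>" unfolding sin_diff by (rule abs_triangle_ineq4)
  moreover have "\<bar>sin a * cos b\<bar> \<le> \<bar>sin a\<bar>" "\<bar>cos a * sin b\<bar> \<le> \<bar>sin b\<bar>"
    by (simp_all add: abs_mult mult_left_le mult_left_le_one_le)
  ultimately show ?thesis by (simp add: abs_mult)
qed

text \<open>A nonzero coordinate contributes at least 1, because its weight and its modulus are both
  at least 1, while the terms of a convergent series tend to 0.\<close>

lemma eta_norm_finite_support:
  assumes "eta_norm \<eta> k < \<infinity>" and "\<eta> > 0"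
  shows "finite {j. k j \<noteq> 0}"
proof -
  have "summable (\<lambda>j. bracket j powr \<eta> * \<bar>real_of_int (k j)\<bar>)"
    using assms(1) unfolding eta_norm_def by (intro summable_suminf_not_top) auto
  then have "(\<lambda>j. bracket j powr \<eta> * \<bar>real_of_int (k j)\<bar>) \<longlonglongrightarrow> 0" by (rule summable_LIMSEQ_zero)
  then have "\<forall>\<^sub>F j in sequentially. bracket j powr \<eta> * \<bar>real_of_int (k j)\<bar> < 1"
    by (intro order_tendstoD) auto
  then obtain J where J: "\<And>j. j \<ge> J \<Longrightarrow> bracket j powr \<eta> * \<bar>real_of_int (k j)\<bar> < 1"
    by (auto simp: eventually_sequentially)
  have "j < J" if "k j \<noteq> 0" for j
  proof (rule ccontr)
    assume "\<not> j < J"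
    then have "bracket j powr \<eta> * \<bar>real_of_int (k j)\<bar> < 1" using J by simp
    moreover have "1 \<le> bracket j powr \<eta>"
      using assms(2) by (intro ge_one_powr_ge_zero) (auto simp: bracket_def)
    moreover have "1 \<le> \<bar>real_of_int (k j)\<bar>" using that by linarith
    ultimately show False
      using mult_mono[of 1 "bracket j powr \<eta>" 1 "\<bar>real_of_int (k j)\<bar>"] by simp
  qed
  then have "{j. k j \<noteq> 0} \<subseteq> {..<J}" by blast
  then show ?thesis by (rule finite_subset) simp
qed

lemma eta_norm_scale: "eta_norm \<eta> (\<lambda>j. c * k j) = ennreal \<bar>of_int c\<bar> * eta_norm \<eta> k"
proof -
  have "ennreal (bracket j powr \<eta> * \<bar>real_of_int (c * k j)\<bar>)
      = ennreal \<bar>of_int c\<bar> * ennreal (bracket j powr \<eta> * \<bar>real_of_int (k j)\<bar>)" for j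
    by (subst ennreal_mult[symmetric]) (simp_all add: abs_mult mult.left_commute)
  then show ?thesis unfolding eta_norm_def ennreal_suminf_cmult[symmetric] by simp
qed

lemma pairing_scale: "c \<noteq> 0 \<Longrightarrow> pairing (\<lambda>j. c * k j) x = of_int c * pairing k x"
  unfolding pairing_def by (simp add: sum_distrib_left mult_ac)

lemma pairing_add: "pairing k (\<lambda>j. x j + y j) = pairing k x + pairing k y"
  unfolding pairing_def by (simp add: sum.distrib algebra_simps)

lemma scale_in_int_vectors_star:
  assumes "k \<in> int_vectors_star \<eta> d" and "c \<noteq> 0"
  shows "(\<lambda>j. c * k j) \<in> int_vectors_star \<eta> d"
proof -
  have "0 < ennreal \<bar>of_int c\<bar>" "ennreal \<bar>of_int c\<bar> < top" using assms(2) by simp_all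
  then have "0 < eta_norm \<eta> (\<lambda>j. c * k j)" "eta_norm \<eta> (\<lambda>j. c * k j) < \<infinity>"
    using assms(1) unfolding eta_norm_scale int_vectors_star_def
    by (simp_all add: ennreal_zero_less_mult_iff ennreal_mult_less_top)
  then show ?thesis using assms(1) by (simp add: int_vectors_star_def int_vectors_def)
qed

text \<open>Apply the Diophantine condition to the multiples of \<open>m\<close> by
  \<open>n\<close>. They share the finite support of \<open>m\<close>, and each factor over it loses
  at most \<open>n powr \<tau>\<close>, so the loss is polynomial even for infinite
  \<open>d\<close>.\<close>

lemma DC_multiples:
  assumes "\<alpha> \<in> DC \<eta> \<tau> d" and "m \<in> int_vectors_star \<eta> d" and "\<eta> > 0" and "\<tau> > 1"
  shows "\<exists>c>0. \<exists>s>0. \<forall>n\<ge>1. c / real n powr s \<le> \<bar>2 * sin (real n * pairing m \<alpha> / 2)\<bar>"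
proof -
  obtain \<gamma> where \<gamma>: "\<gamma> > 0" "\<alpha> \<in> DC_const \<eta> \<tau> d \<gamma>"
    using assms(1) by (auto simp: DC_def)
  define J where "J = {j. m j \<noteq> 0}"
  have fin: "finite J" unfolding J_def using assms eta_norm_finite_support
    by (auto simp: int_vectors_star_def)
  have "J \<noteq> {}"
  proof
    assume "J = {}"
    then have "m = (\<lambda>_. 0)" by (auto simp: J_def)
    then show False using assms(2) by (simp add: int_vectors_star_def eta_norm_def)
  qed
  define u where "u j = 1 + bracket j powr \<tau> * \<bar>real_of_int (m j)\<bar> powr \<tau>" for j
  have u: "u j > 0" for j by (simp add: u_def add_pos_nonneg)
  \<comment> \<open>The distance from \<open>n * pairing m \<alpha>\<close> to the multiples of
    \<open>2 * pi\<close> is twice that from the half angle to the multiples of \<open>pi\<close>,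
    hence at most 3 times the sine divisor. This is the 3 in \<open>c\<close>.\<close>
  define c where "c = \<gamma> / 3 * (\<Prod>j\<in>J. 1 / u j)"
  define s where "s = \<tau> * real (card J)"
  have "c / real n powr s \<le> \<bar>2 * sin (real n * pairing m \<alpha> / 2)\<bar>" if "n \<ge> 1" for n
  proof -
    define k where "k = (\<lambda>j. int n * m j)"
    have k: "k \<in> int_vectors_star \<eta> d"
      unfolding k_def using assms(2) that by (intro scale_in_int_vectors_star) auto
    have supp: "{j. k j \<noteq> 0} = J" using that by (auto simp: k_def J_def)
    have pk: "pairing k \<alpha> = real n * pairing m \<alpha>"
      using that by (simp add: k_def pairing_scale)
    obtain l :: int where l: "\<bar>real n * pairing m \<alpha> / 2 - of_int l * pi\<bar> / 3
        \<le> \<bar>sin (real n * pairing m \<alpha> / 2)\<bar>"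
      by (rule abs_sin_ge_dist_multiple_pi)
    have "\<gamma> * (\<Prod>j\<in>J. 1 / (1 + bracket j powr \<tau> * \<bar>real_of_int (k j)\<bar> powr \<tau>))
        \<le> (INF n::int. \<bar>pairing k \<alpha> - 2 * pi * real_of_int n\<bar>)"
      using \<gamma>(2) k supp by (auto simp: DC_const_def)
    also have "\<dots> \<le> \<bar>pairing k \<alpha> - 2 * pi * real_of_int l\<bar>"
      by (intro cINF_lower bdd_belowI2[of _ 0]) auto
    also have "\<dots> = 2 * \<bar>real n * pairing m \<alpha> / 2 - of_int l * pi\<bar>"
      by (simp add: pk abs_if field_simps)
    finally have 1: "\<gamma> / 3 * (\<Prod>j\<in>J. 1 / (1 + bracket j powr \<tau> * \<bar>real_of_int (k j)\<bar> powr \<tau>))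
        \<le> \<bar>2 * sin (real n * pairing m \<alpha> / 2)\<bar>" using l by (simp add: abs_mult)
    have "1 / u j / real n powr \<tau> \<le> 1 / (1 + bracket j powr \<tau> * \<bar>real_of_int (k j)\<bar> powr \<tau>)" for j
    proof -
      have "1 \<le> real n powr \<tau>" using that assms(4) by (intro ge_one_powr_ge_zero) auto
      moreover have "\<bar>real_of_int (k j)\<bar> powr \<tau> = real n powr \<tau> * \<bar>real_of_int (m j)\<bar> powr \<tau>"
        by (simp add: k_def abs_mult powr_mult)
      ultimately have "1 + bracket j powr \<tau> * \<bar>real_of_int (k j)\<bar> powr \<tau> \<le> u j * real n powr \<tau>"
        by (simp add: u_def algebra_simps)
      then show ?thesis
        by (simp add: frac_le add_pos_nonneg)
    qed
    then have "(\<Prod>j\<in>J. 1 / u j / real n powr \<tau>)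
        \<le> (\<Prod>j\<in>J. 1 / (1 + bracket j powr \<tau> * \<bar>real_of_int (k j)\<bar> powr \<tau>))"
      using u by (intro prod_mono conjI) (auto simp: less_imp_le)
    moreover have "(\<Prod>j\<in>J. 1 / u j / real n powr \<tau>) = (\<Prod>j\<in>J. 1 / u j) / real n powr s"
    proof -
      have "(real n powr \<tau>) ^ card J = real n powr s"
        using that by (simp add: s_def powr_powr flip: powr_realpow)
      then show ?thesis by (simp add: prod_dividef prod.distrib)
    qed
    ultimately have "\<gamma> / 3 * ((\<Prod>j\<in>J. 1 / u j) / real n powr s) \<le> \<gamma> / 3 *
        (\<Prod>j\<in>J. 1 / (1 + bracket j powr \<tau> * \<bar>real_of_int (k j)\<bar> powr \<tau>))"
      using \<gamma>(1) by (intro mult_left_mono) auto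
    moreover have "c / real n powr s = \<gamma> / 3 * ((\<Prod>j\<in>J. 1 / u j) / real n powr s)"
      by (simp only: c_def times_divide_eq_right)
    ultimately have "c / real n powr s \<le> \<gamma> / 3 *
        (\<Prod>j\<in>J. 1 / (1 + bracket j powr \<tau> * \<bar>real_of_int (k j)\<bar> powr \<tau>))"
      by (simp only:)
    then show ?thesis using 1 by linarith
  qed
  moreover have "c > 0" using \<gamma> u by (simp add: c_def prod_pos)
  moreover have "s > 0" using assms(4) fin \<open>J \<noteq> {}\<close> by (simp add: s_def card_gt_0_iff)
  ultimately show ?thesis by blast
qed

subsection \<open>Bloch solutions at the resonant energy\<close>

unbundle no vec_syntax and fps_syntax

text \<open>
  The coefficient of \<open>X ^ n\<close> in these power series is the coefficient of
  \<open>e\<^bsup>i(n - 1/2)\<theta>\<^esup>\<close> in the corresponding function of \<open>\<theta> = \<langle>m, x\<rangle>\<close>.  Both \<open>bloch_divisor \<omega> 0\<close> and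
  \<open>bloch_divisor \<omega> 1\<close> vanish; hence the products start at \<open>j = 2\<close>.
\<close>

definition bloch_divisor :: "real \<Rightarrow> nat \<Rightarrow> real" where
  "bloch_divisor \<omega> n = 2 * cos (\<omega>/2) - 2 * cos ((real n - 1/2) * \<omega>)"

text \<open>The value \<zeta> that solves the equation at \<open>n = 1\<close>, where the divisor
  vanishes: \<open>\<mu> * g + \<zeta> * 2i sin(\<omega>/2) = 0\<close> with
  \<open>g = 1 / (2i sin(\<omega>/2))\<close>, the constant coefficient of the generalized
  solution.\<close>

definition jordan_entry :: "real \<Rightarrow> real \<Rightarrow> real" where
  "jordan_entry \<omega> \<mu> = \<mu> / (4 * (sin (\<omega>/2))\<^sup>2)"

text \<open>Closed form of the recursion \<open>b_n F_n = \<mu> F_(n-1)\<close>, started at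
  \<open>F_1 = 1\<close>, with \<open>b_n\<close> the Bloch divisor.\<close>

definition bloch_solution :: "real \<Rightarrow> real \<Rightarrow> complex fps" where
  "bloch_solution \<omega> \<mu> = Abs_fps (\<lambda>n. if n = 0 then 0
     else of_real (\<mu> ^ (n - 1) / (\<Prod>j=2..n. bloch_divisor \<omega> j)))"

text \<open>Variation of constants: the ratio to the Bloch solution accumulates the forcing. The
  constant coefficient normalizes the Wronskian; the free coefficient at \<open>n = 1\<close> is 0,
  as the sum is empty there.\<close>

definition generalized_solution :: "real \<Rightarrow> real \<Rightarrow> complex fps" where
  "generalized_solution \<omega> \<mu> = Abs_fps (\<lambda>n. if n = 0 then 1 / (2 * \<i> * of_real (sin (\<omega>/2)))
     else bloch_solution \<omega> \<mu> $ n *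
       (2 * \<i> * of_real (\<Sum>j=2..n. jordan_entry \<omega> \<mu> * sin ((real j - 1/2) * \<omega>) / bloch_divisor \<omega> j)))"

lemma bloch_divisor_eq:
  assumes "n \<ge> 1"
  shows "bloch_divisor \<omega> n = (2 * sin (real n * \<omega> / 2)) * (2 * sin (real (n - 1) * \<omega> / 2))"
proof -
  have e: "\<omega> / 2 = real n * \<omega> / 2 - real (n - 1) * \<omega> / 2"
    "(real n - 1/2) * \<omega> = real n * \<omega> / 2 + real (n - 1) * \<omega> / 2"
    using assms by (simp_all add: of_nat_diff field_simps)
  show ?thesis unfolding bloch_divisor_def e cos_diff cos_add by simp
qed

lemma bloch_divisor_nonzero:
  assumes "\<And>n. n \<ge> 1 \<Longrightarrow> sin (real n * \<omega> / 2) \<noteq> 0" and "n \<ge> 2"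
  shows "bloch_divisor \<omega> n \<noteq> 0"
  using assms(1)[of n] assms(1)[of "n - 1"] assms(2) by (simp add: bloch_divisor_eq)

text \<open>Each factor splits into the sine divisors at \<open>j\<close> and \<open>j - 1\<close>,
  so the product is that of two sine products divided by the first divisor, which is at most 2. That
  2 is absorbed into \<open>2 ^ n\<close>.\<close>

lemma bloch_divisor_prod_ge:
  assumes "K \<ge> 1" and "\<And>n. 1 / K ^ n \<le> (\<Prod>j=1..n. \<bar>2 * sin (real j * \<omega> / 2)\<bar>)"
  shows "1 / (2 * K\<^sup>2) ^ n \<le> (\<Prod>j=2..n. \<bar>bloch_divisor \<omega> j\<bar>)"
proof (cases "n = 0")
  case False
  define D where "D j = \<bar>2 * sin (real j * \<omega> / 2)\<bar>" for j :: nat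
  define P where "P n = (\<Prod>j=1..n. D j)" for n
  define R where "R n = (\<Prod>j=2..n. \<bar>bloch_divisor \<omega> j\<bar>)" for n
  have P: "1 / K ^ n \<le> P n" for n using assms(2) by (simp add: P_def D_def)
  have P0: "P n \<ge> 0" for n by (simp add: P_def D_def prod_nonneg)
  have R0: "R n \<ge> 0" for n by (simp add: R_def prod_nonneg)
  have D2: "D 1 \<le> 2" using abs_sin_le_one[of "\<omega>/2"] by (simp add: D_def abs_mult)
  have "R (Suc n) * D 1 = P (Suc n) * P n" for n
  proof (induction n)
    case (Suc n)
    have "R (Suc (Suc n)) = R (Suc n) * (D (Suc (Suc n)) * D (Suc n))"
      by (simp add: R_def D_def bloch_divisor_eq abs_mult)
    moreover have "P (Suc (Suc n)) = P (Suc n) * D (Suc (Suc n))" "P (Suc n) = P n * D (Suc n)"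
      by (simp_all add: P_def)
    ultimately show ?case using Suc.IH by (simp add: algebra_simps)
  qed (simp add: R_def P_def)
  from this[of "n - 1"] False have "P n * P (n - 1) = R n * D 1" by simp
  also have "\<dots> \<le> R n * 2" using D2 R0 by (intro mult_left_mono)
  finally have 1: "P n * P (n - 1) \<le> R n * 2" .
  have "1 / K ^ n \<le> 1 / K ^ (n - 1)" using assms(1) by (intro divide_left_mono power_increasing) auto
  then have "1 / K ^ n * (1 / K ^ n) \<le> P n * P (n - 1)"
    using P[of n] P[of "n - 1"] P0[of n] assms(1) by (intro mult_mono) (auto intro: order.trans)
  from order.trans[OF this 1] have "1 / K ^ n * (1 / K ^ n) / 2 \<le> R n" by simp
  moreover have "1 / (2 * K\<^sup>2) ^ n \<le> 1 / K ^ n * (1 / K ^ n) / 2"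
  proof -
    have "2 ^ 1 \<le> (2::real) ^ n" using False by (intro power_increasing) auto
    then have "(K ^ n * K ^ n) * 2 \<le> (K ^ n * K ^ n) * 2 ^ n"
      using assms(1) by (intro mult_left_mono) auto
    also have "\<dots> = (2 * K\<^sup>2) ^ n" by (simp add: power_mult_distrib power2_eq_square mult_ac)
    finally show ?thesis using assms(1) by (simp add: frac_le)
  qed
  ultimately show ?thesis by (simp add: R_def)
qed simp

text \<open>In the rate, one \<open>K\<close> bounds the inverse product, \<open>4 * K\<close> a
  single inverse divisor, and the remaining 2 the number of summands, through
  \<open>n - 1 \<le> 2 ^ n\<close>. \<open>C\<close> may depend on \<mu>, as only the rate decides
  convergence.\<close>

lemma solution_coeff_bounds:
  assumes "K \<ge> 1" and prod: "\<And>n. 1 / K ^ n \<le> (\<Prod>j=2..n. \<bar>bloch_divisor \<omega> j\<bar>)" and "\<mu> \<noteq> 0"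
  shows "\<exists>C. \<forall>n. norm (bloch_solution \<omega> \<mu> $ n) \<le> C * (8 * K\<^sup>2 * \<bar>\<mu>\<bar>) ^ n \<and>
     norm (generalized_solution \<omega> \<mu> $ n) \<le> C * (8 * K\<^sup>2 * \<bar>\<mu>\<bar>) ^ n"
proof -
  define z where "z = \<bar>jordan_entry \<omega> \<mu>\<bar>"
  have F: "norm (bloch_solution \<omega> \<mu> $ n) \<le> 1 / \<bar>\<mu>\<bar> * (K * \<bar>\<mu>\<bar>) ^ n" for n
  proof (cases n)
    case (Suc k)
    have pos: "0 < 1 / K ^ n" using assms(1) by simp
    have "1 / (\<Prod>j=2..n. \<bar>bloch_divisor \<omega> j\<bar>) \<le> 1 / (1 / K ^ n)"
      using prod[of n] pos by (intro divide_left_mono mult_pos_pos order.strict_trans2[OF pos prod]) auto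
    then have "\<bar>\<mu>\<bar> ^ k * (1 / (\<Prod>j=2..n. \<bar>bloch_divisor \<omega> j\<bar>)) \<le> \<bar>\<mu>\<bar> ^ k * K ^ n"
      by (intro mult_left_mono) auto
    moreover have "\<bar>\<mu>\<bar> ^ k * K ^ n = 1 / \<bar>\<mu>\<bar> * (K * \<bar>\<mu>\<bar>) ^ n"
      using assms(3) by (simp add: Suc power_mult_distrib)
    ultimately show ?thesis
      by (simp add: bloch_solution_def Suc norm_divide norm_power prod_norm flip: abs_prod)
  qed (simp add: bloch_solution_def)
  have div4: "\<bar>bloch_divisor \<omega> j\<bar> \<le> 4" for j
    unfolding bloch_divisor_def using cos_le_one[of "\<omega>/2"] cos_ge_minus_one[of "\<omega>/2"]
      cos_le_one[of "(real j - 1/2) * \<omega>"] cos_ge_minus_one[of "(real j - 1/2) * \<omega>"] by linarith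
  \<comment> \<open>The lower bound on the product controls a single divisor because every other
    factor is at most 4.\<close>
  have inv: "1 / \<bar>bloch_divisor \<omega> j\<bar> \<le> (4 * K) ^ j" if "j \<ge> 2" for j
  proof -
    have "1 / K ^ j \<le> (\<Prod>i=2..j. \<bar>bloch_divisor \<omega> i\<bar>)" by (rule prod)
    also have "{2..j} = insert j {2..j - 1}" using that by auto
    then have "(\<Prod>i=2..j. \<bar>bloch_divisor \<omega> i\<bar>) = \<bar>bloch_divisor \<omega> j\<bar> * (\<Prod>i=2..j - 1. \<bar>bloch_divisor \<omega> i\<bar>)"
      using that by (simp del: abs_prod)
    also have "\<dots> \<le> \<bar>bloch_divisor \<omega> j\<bar> * 4 ^ j"
    proof (intro mult_left_mono)
      have "(\<Prod>i=2..j - 1. \<bar>bloch_divisor \<omega> i\<bar>) \<le> (\<Prod>i=2..j - 1. 4)"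
        using div4 by (intro prod_mono) auto
      also have "\<dots> \<le> 4 ^ j" by (simp add: power_increasing)
      finally show "(\<Prod>i=2..j - 1. \<bar>bloch_divisor \<omega> i\<bar>) \<le> 4 ^ j" .
    qed auto
    finally have le: "1 / K ^ j \<le> \<bar>bloch_divisor \<omega> j\<bar> * 4 ^ j" .
    moreover have "0 < 1 / K ^ j" using assms(1) by simp
    ultimately have "\<bar>bloch_divisor \<omega> j\<bar> * 4 ^ j > 0" by linarith
    then have "\<bar>bloch_divisor \<omega> j\<bar> > 0" by (simp add: zero_less_mult_iff)
    then show ?thesis using le assms(1) by (simp add: field_simps power_mult_distrib)
  qed
  have G: "norm (generalized_solution \<omega> \<mu> $ n) \<le> 2 * z / \<bar>\<mu>\<bar> * (8 * K\<^sup>2 * \<bar>\<mu>\<bar>) ^ n" if "n \<ge> 1" for n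
  proof -
    have "\<bar>\<Sum>j=2..n. jordan_entry \<omega> \<mu> * sin ((real j - 1/2) * \<omega>) / bloch_divisor \<omega> j\<bar>
        \<le> (\<Sum>j=2..n. \<bar>jordan_entry \<omega> \<mu> * sin ((real j - 1/2) * \<omega>) / bloch_divisor \<omega> j\<bar>)"
      by (rule sum_abs)
    also have "\<dots> \<le> (\<Sum>j=2..n. z * (4 * K) ^ n)"
    proof (rule sum_mono)
      fix j assume j: "j \<in> {2..n}"
      have "\<bar>sin ((real j - 1/2) * \<omega>)\<bar> * (1 / \<bar>bloch_divisor \<omega> j\<bar>) \<le> 1 * (4 * K) ^ j"
        using inv[of j] j by (intro mult_mono) auto
      also have "1 * (4 * K) ^ j \<le> (4 * K) ^ n"
        unfolding mult_1 using j assms(1) by (intro power_increasing) auto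
      finally have "z * (\<bar>sin ((real j - 1/2) * \<omega>)\<bar> * (1 / \<bar>bloch_divisor \<omega> j\<bar>)) \<le> z * (4 * K) ^ n"
        by (intro mult_left_mono) (auto simp: z_def)
      then show "\<bar>jordan_entry \<omega> \<mu> * sin ((real j - 1/2) * \<omega>) / bloch_divisor \<omega> j\<bar> \<le> z * (4 * K) ^ n"
        by (simp add: abs_mult z_def)
    qed
    also have "\<dots> = real (n - 1) * (z * (4 * K) ^ n)" by simp
    also have "\<dots> \<le> 2 ^ n * (z * (4 * K) ^ n)"
    proof (rule mult_right_mono)
      show "real (n - 1) \<le> 2 ^ n" using of_nat_less_two_power[of n, where 'a = real] by linarith
    qed (use assms(1) in \<open>simp add: z_def\<close>)
    also have "\<dots> = z * (2 * (4 * K)) ^ n" unfolding power_mult_distrib[of 2 "4 * K"] by (rule mult.left_commute)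
    also have "2 * (4 * K) = 8 * K" by simp
    finally have "norm (bloch_solution \<omega> \<mu> $ n) *
        (2 * \<bar>\<Sum>j=2..n. jordan_entry \<omega> \<mu> * sin ((real j - 1/2) * \<omega>) / bloch_divisor \<omega> j\<bar>)
        \<le> (1 / \<bar>\<mu>\<bar> * (K * \<bar>\<mu>\<bar>) ^ n) * (2 * (z * (8 * K) ^ n))"
      using F[of n] assms(1) by (intro mult_mono) auto
    also have "\<dots> = 2 * z / \<bar>\<mu>\<bar> * (8 * K\<^sup>2 * \<bar>\<mu>\<bar>) ^ n"
      by (simp add: power_mult_distrib power2_eq_square)
    finally show ?thesis
      using that by (simp add: generalized_solution_def norm_mult del: of_real_sum)
  qed
  \<comment> \<open>The last summand covers the index 0, which the estimate for
    \<open>n \<ge> 1\<close> leaves out.\<close>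
  define C where "C = 1 / \<bar>\<mu>\<bar> + 2 * z / \<bar>\<mu>\<bar> + norm (generalized_solution \<omega> \<mu> $ 0)"
  have z: "z \<ge> 0" by (simp add: z_def)
  show ?thesis
  proof (intro exI[of _ C] allI conjI)
    fix n
    have "K * \<bar>\<mu>\<bar> \<le> 8 * K\<^sup>2 * \<bar>\<mu>\<bar>"
      using assms(1) by (intro mult_right_mono) (auto simp: power2_eq_square)
    then have "(K * \<bar>\<mu>\<bar>) ^ n \<le> (8 * K\<^sup>2 * \<bar>\<mu>\<bar>) ^ n" using assms(1) by (intro power_mono) auto
    then have "1 / \<bar>\<mu>\<bar> * (K * \<bar>\<mu>\<bar>) ^ n \<le> C * (8 * K\<^sup>2 * \<bar>\<mu>\<bar>) ^ n"
      using assms(1) z by (intro mult_mono) (auto simp: C_def)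
    then show "norm (bloch_solution \<omega> \<mu> $ n) \<le> C * (8 * K\<^sup>2 * \<bar>\<mu>\<bar>) ^ n" using F[of n] by linarith
    show "norm (generalized_solution \<omega> \<mu> $ n) \<le> C * (8 * K\<^sup>2 * \<bar>\<mu>\<bar>) ^ n"
    proof (cases "n = 0")
      case True
      then show ?thesis using z by (simp add: C_def)
    next
      case False
      have "2 * z / \<bar>\<mu>\<bar> * (8 * K\<^sup>2 * \<bar>\<mu>\<bar>) ^ n \<le> C * (8 * K\<^sup>2 * \<bar>\<mu>\<bar>) ^ n"
        using z by (intro mult_right_mono) (auto simp: C_def)
      then show ?thesis using G[of n] False by linarith
    qed
  qed
qed

text \<open>The translation \<open>\<theta> \<mapsto> \<theta> + \<omega>\<close> in terms of the coefficients of \<open>e\<^bsup>i(n - 1/2)\<theta>\<^esup>\<close>.\<close>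

definition twist :: "real \<Rightarrow> complex fps \<Rightarrow> complex fps" where
  "twist \<omega> F = Abs_fps (\<lambda>n. cis ((real n - 1/2) * \<omega>) * F $ n)"

lemma twist_nth [simp]: "twist \<omega> F $ n = cis ((real n - 1/2) * \<omega>) * F $ n"
  by (simp add: twist_def)

lemma twist_twist_minus [simp]: "twist \<omega> (twist (- \<omega>) F) = F"
  by (simp add: fps_eq_iff cis_mult mult.assoc[symmetric])

text \<open>The half-integer phases at \<open>i\<close> and \<open>n - i\<close> have the same sum
  for every \<open>i\<close>, so the product acquires an integer phase, trivial at
  \<open>n = 1\<close>.\<close>

lemma twist_mult_twist: "(twist \<omega> F * twist \<omega> G) $ n = cis ((real n - 1) * \<omega>) * (F * G) $ n"
proof -
  have "cis ((real i - 1/2) * \<omega>) * F $ i * (cis ((real (n - i) - 1/2) * \<omega>) * G $ (n - i))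
      = cis ((real n - 1) * \<omega>) * (F $ i * G $ (n - i))" if "i \<le> n" for i
  proof -
    have "cis ((real i - 1/2) * \<omega>) * cis ((real (n - i) - 1/2) * \<omega>) = cis ((real n - 1) * \<omega>)"
      using that by (simp add: cis_mult of_nat_diff algebra_simps)
    then show ?thesis by (metis mult.assoc mult.left_commute)
  qed
  then show ?thesis
    unfolding fps_mult_nth sum_distrib_left by (intro sum.cong refl) simp
qed

text \<open>Turns the formal twist into a rotation of the argument; the scalar
  \<open>cis (- \<omega>/2)\<close> comes from the half in the exponent.\<close>

lemma eval_fps_twist:
  assumes "norm z < fps_conv_radius F"
  shows "eval_fps (twist \<omega> F) z = cis (- \<omega>/2) * eval_fps F (cis \<omega> * z)"
proof -
  have "(\<lambda>n. F $ n * (cis \<omega> * z) ^ n) sums eval_fps F (cis \<omega> * z)"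
    using assms by (intro sums_eval_fps) (simp add: norm_mult)
  then have "(\<lambda>n. cis (- \<omega>/2) * (F $ n * (cis \<omega> * z) ^ n)) sums (cis (- \<omega>/2) * eval_fps F (cis \<omega> * z))"
    by (rule sums_mult)
  moreover have "cis (- \<omega>/2) * (F $ n * (cis \<omega> * z) ^ n) = twist \<omega> F $ n * z ^ n" for n
  proof -
    have "cis (- \<omega>/2) * cis \<omega> ^ n = cis ((real n - 1/2) * \<omega>)"
      by (simp add: Complex.DeMoivre cis_mult left_diff_distrib)
    then show ?thesis unfolding twist_nth power_mult_distrib by (metis mult.assoc mult.left_commute)
  qed
  ultimately have "(\<lambda>n. twist \<omega> F $ n * z ^ n) sums (cis (- \<omega>/2) * eval_fps F (cis \<omega> * z))" by (simp only:)
  then show ?thesis by (simp only: eval_fps_def[of "twist \<omega> F"] sums_iff)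
qed

section \<open>The Schroedinger equation and the Wronskian for formal series\<close>

context
  fixes \<omega> \<mu> :: real and F G L Z :: "complex fps"
  assumes nonres: "\<And>n. n \<ge> 1 \<Longrightarrow> sin (real n * \<omega> / 2) \<noteq> 0"
  defines "F \<equiv> bloch_solution \<omega> \<mu>" and "G \<equiv> generalized_solution \<omega> \<mu>"
    and "L \<equiv> fps_const (of_real (2 * cos (\<omega>/2))) - fps_const (of_real \<mu>) * fps_X"
    and "Z \<equiv> fps_const (of_real (jordan_entry \<omega> \<mu>))"
begin

private lemma cis_sum: "cis t + cis (- t) = of_real (2 * cos t)"
  by (simp add: complex_eq_iff)

private lemma cis_diff: "cis t - cis (- t) = 2 * \<i> * of_real (sin t)"
  by (simp add: complex_eq_iff)

private lemma F0: "F $ 0 = 0" and F1: "F $ 1 = 1"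
  by (simp_all add: F_def bloch_solution_def)

private lemma G0: "G $ 0 = 1 / (2 * \<i> * of_real (sin (\<omega>/2)))"
  by (simp add: G_def generalized_solution_def)

private lemma F_step: "of_real (bloch_divisor \<omega> n) * F $ n = (if n = 0 then 0 else of_real \<mu> * F $ (n - 1))"
proof -
  consider "n = 0" | "n = 1" | k where "n = Suc (Suc k)" by (metis One_nat_def nat.exhaust)
  then show ?thesis
  proof cases
    case 3
    then have "of_real (bloch_divisor \<omega> n) \<noteq> (0::complex)" using bloch_divisor_nonzero[OF nonres] by simp
    then show ?thesis by (simp add: 3 F_def bloch_solution_def)
  qed (simp_all add: F0 bloch_divisor_def)
qed

text \<open>At \<open>n = 0\<close> both sides vanish. At \<open>n = 1\<close> the divisor vanishes
  and the right side cancels by the choice of \<open>jordan_entry\<close>. From \<open>n = 2\<close>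
  on, the sum gains one term, whose denominator is the divisor itself.\<close>

private lemma G_step: "of_real (bloch_divisor \<omega> n) * G $ n = (if n = 0 then 0 else of_real \<mu> * G $ (n - 1))
   + of_real (jordan_entry \<omega> \<mu>) * (2 * \<i> * of_real (sin ((real n - 1/2) * \<omega>))) * F $ n"
proof -
  consider "n = 0" | "n = 1" | k where "n = Suc (Suc k)" by (metis One_nat_def nat.exhaust)
  then show ?thesis
  proof cases
    case 2
    define s where "s = complex_of_real (sin (\<omega>/2))"
    have "s \<noteq> 0" using nonres[of 1] by (simp add: s_def)
    then have "of_real \<mu> * (1 / (2 * \<i> * s)) + of_real \<mu> / (4 * s\<^sup>2) * (2 * \<i> * s) = 0"
      by (simp add: divide_simps power2_eq_square)
    then show ?thesis using 2 F1 G0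
      by (simp add: bloch_divisor_def jordan_entry_def s_def)
  next
    case 3
    define e where "e n = (\<Sum>j=2..n. jordan_entry \<omega> \<mu> * sin ((real j - 1/2) * \<omega>) / bloch_divisor \<omega> j)" for n
    have nz: "bloch_divisor \<omega> n \<noteq> 0" using bloch_divisor_nonzero[OF nonres] 3 by simp
    have e: "bloch_divisor \<omega> n * e n = bloch_divisor \<omega> n * e (Suc k) + jordan_entry \<omega> \<mu> * sin ((real n - 1/2) * \<omega>)"
      using nz by (simp add: e_def 3 field_simps)
    have Gn: "G $ Suc j = F $ Suc j * (2 * \<i> * of_real (e (Suc j)))" for j
      by (simp add: G_def generalized_solution_def F_def e_def)
    have "of_real (bloch_divisor \<omega> n) * G $ n = F $ n * (2 * \<i> * of_real (bloch_divisor \<omega> n * e n))"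
      using Gn[of "Suc k"] by (simp add: 3 mult_ac)
    also have "\<dots> = (of_real (bloch_divisor \<omega> n) * F $ n) * (2 * \<i> * of_real (e (Suc k)))
       + of_real (jordan_entry \<omega> \<mu>) * (2 * \<i> * of_real (sin ((real n - 1/2) * \<omega>))) * F $ n"
      unfolding e by (simp add: algebra_simps)
    also have "of_real (bloch_divisor \<omega> n) * F $ n = of_real \<mu> * F $ Suc k" using F_step[of n] 3 by simp
    finally show ?thesis using Gn[of k] by (simp add: 3 mult_ac)
  qed (simp_all add: F0 bloch_divisor_def)
qed

text \<open>\<open>L\<close> is multiplication by the energy minus the potential. By
  \<open>F_step\<close> it multiplies coefficient \<open>n\<close> of \<open>F\<close> by
  \<open>2 cos ((n - 1/2)\<omega>)\<close>, the sum of the forward and backward phases.\<close>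

lemma twist_bloch_solution: "twist \<omega> F = L * F - twist (- \<omega>) F"
proof (rule fps_ext)
  fix n
  have "(L * F) $ n = of_real (2 * cos (\<omega>/2)) * F $ n - (if n = 0 then 0 else of_real \<mu> * F $ (n - 1))"
    by (cases n) (simp_all add: L_def left_diff_distrib mult.assoc)
  also have "\<dots> = of_real (2 * cos ((real n - 1/2) * \<omega>)) * F $ n"
    unfolding F_step[symmetric] by (simp add: bloch_divisor_def algebra_simps)
  finally show "twist \<omega> F $ n = (L * F - twist (- \<omega>) F) $ n"
    unfolding cis_sum[symmetric] by (simp add: algebra_simps)
qed

text \<open>The forcing in \<open>G_step\<close> is the forward minus the backward shift of
  \<open>Z * F\<close>. Grouping the backward half with \<open>G\<close> gives the form needed for
  the second column of the conjugacy.\<close>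

lemma twist_generalized_solution:
  "twist \<omega> G = L * G - twist (- \<omega>) (G - Z * F) - Z * twist \<omega> F"
proof (rule fps_ext)
  fix n
  let ?t = "(real n - 1/2) * \<omega>"
  have "(L * G) $ n = of_real (2 * cos (\<omega>/2)) * G $ n - (if n = 0 then 0 else of_real \<mu> * G $ (n - 1))"
    by (cases n) (simp_all add: L_def left_diff_distrib mult.assoc)
  also have "\<dots> = of_real (2 * cos ?t) * G $ n + of_real (jordan_entry \<omega> \<mu>) * (2 * \<i> * of_real (sin ?t)) * F $ n"
    using G_step[of n] by (simp add: bloch_divisor_def algebra_simps)
  finally show "twist \<omega> G $ n = (L * G - twist (- \<omega>) (G - Z * F) - Z * twist \<omega> F) $ n"
    unfolding cis_sum[symmetric] cis_diff[symmetric] by (simp add: Z_def algebra_simps)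
qed

text \<open>
  The Wronskian is invariant under the translation by \<open>\<omega>\<close>, so by nonresonance all its coefficients
  but one vanish.  The factor \<open>X\<close> is cancelled by the two half-integer phases in \<open>solution_matrix\<close>.
\<close>

lemma solution_wronskian:
  "F * twist (- \<omega>) (G - Z * F) - twist (- \<omega>) F * G = fps_X"
proof (rule fps_ext)
  define Q where "Q = twist (- \<omega>) (G - Z * F)"
  define W where "W = F * Q - twist (- \<omega>) F * G"
  have "twist \<omega> F * twist \<omega> Q - twist \<omega> (twist (- \<omega>) F) * twist \<omega> G
      = twist \<omega> F * (G - Z * F) - F * twist \<omega> G" by (simp add: Q_def)
  \<comment> \<open>After substituting both shift identities, the terms with \<open>L\<close> and
    those with \<open>Z\<close> cancel, as a transfer matrix and a Jordan block of determinant 1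
    must allow.\<close>
  also have "\<dots> = W"
    unfolding twist_generalized_solution twist_bloch_solution W_def Q_def
    by (simp add: algebra_simps)
  finally have inv: "twist \<omega> F * twist \<omega> Q - twist \<omega> (twist (- \<omega>) F) * twist \<omega> G = W" .
  have W: "(cis ((real n - 1) * \<omega>) - 1) * W $ n = 0" for n
  proof -
    have "W $ n = cis ((real n - 1) * \<omega>) * (F * Q) $ n - cis ((real n - 1) * \<omega>) * (twist (- \<omega>) F * G) $ n"
      by (subst inv[symmetric]) (simp only: fps_sub_nth twist_mult_twist)
    also have "\<dots> = cis ((real n - 1) * \<omega>) * W $ n" by (simp only: W_def fps_sub_nth right_diff_distrib)
    finally show ?thesis by (simp only: left_diff_distrib mult_1) simp
  qed
  fix n
  consider "n = 0" | "n = 1" | k where "n = Suc (Suc k)" by (metis One_nat_def nat.exhaust)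
  then have "W $ n = fps_X $ n"
  proof cases
    case 1
    then show ?thesis by (simp add: W_def F0)
  next
    case 2
    have "sin (\<omega>/2) \<noteq> 0" using nonres[of 1] by simp
    \<comment> \<open>Only \<open>F $ 0 = 0\<close> and \<open>F $ 1 = 1\<close> enter, and
      \<open>G $ 0\<close> was chosen to make this value 1.\<close>
    moreover have "W $ 1 = (cis (\<omega>/2) - cis (- (\<omega>/2))) * G $ 0"
      by (simp add: W_def Q_def fps_mult_nth Z_def F0 F1[simplified] algebra_simps)
    ultimately show ?thesis unfolding cis_diff G0 using 2 by simp
  next
    case 3
    have "cis (real (Suc k) * \<omega>) \<noteq> 1"
    proof
      assume "cis (real (Suc k) * \<omega>) = 1"
      then have "cos (2 * (real (Suc k) * \<omega> / 2)) = 1" by (simp add: complex_eq_iff)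
      then show False using nonres[of "Suc k"] by (simp only: cos_double_sin) simp
    qed
    then show ?thesis using W[of n] 3 by (simp add: fps_X_def)
  qed
  then show "(F * twist (- \<omega>) (G - Z * F) - twist (- \<omega>) F * G) $ n = fps_X $ n"
    by (simp add: W_def Q_def)
qed

end

subsection \<open>The conjugating matrix\<close>

unbundle no fps_syntax and vec_syntax

lemma vec_has_sumI:
  assumes "\<And>i. ((\<lambda>k. f k $ i) has_sum S $ i) A"
  shows "(f has_sum S) A"
  using assms unfolding has_sum_def by (intro vec_tendstoI) simp

lemma norm_vec_le_sum: "norm x \<le> (\<Sum>i\<in>UNIV. norm (x $ i))"
  unfolding norm_vec_def by (intro L2_set_le_sum) simp

lemma matrix_inv_mult_self:
  fixes A :: "'a::field^'n^'n"
  assumes "det A \<noteq> 0"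
  shows "matrix_inv A ** A = mat 1"
proof -
  obtain A' where "A ** A' = mat 1 \<and> A' ** A = mat 1"
    using assms by (auto simp: invertible_det_nz[symmetric] invertible_def)
  then show ?thesis unfolding matrix_inv_def by (rule someI2) simp
qed

lemma int_vectors_starD:
  assumes "m \<in> int_vectors_star \<eta> d" and "\<eta> > 0"
  shows "m \<in> fin_int_vectors d" and "\<exists>j. m j \<noteq> 0" and "enn2real (eta_norm \<eta> m) > 0"
proof -
  show "m \<in> fin_int_vectors d"
    using assms eta_norm_finite_support[of \<eta> m] by (simp add: int_vectors_star_def fin_int_vectors_def)
  show "enn2real (eta_norm \<eta> m) > 0"
    using assms by (simp add: int_vectors_star_def enn2real_positive_iff)
  show "\<exists>j. m j \<noteq> 0"
  proof (rule ccontr)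
    assume "\<nexists>j. m j \<noteq> 0"
    then show False using assms(1) by (simp add: int_vectors_star_def eta_norm_def)
  qed
qed

text \<open>The phase \<open>(n - 1/2) * \<theta>\<close> is half the pairing of \<open>x\<close>
  with the odd multiple \<open>2 * n - 1\<close> of \<open>m\<close>, so half-integer exponents live
  on the doubled torus. Distinct \<open>n\<close> give distinct vectors, coefficients elsewhere are
  0, and \<open>h = 1\<close> works.\<close>

lemma half_integer_series_in_analytic_SL2:
  fixes M :: "nat \<Rightarrow> complex^2^2" and U :: "real \<Rightarrow> complex^2^2"
  assumes m: "m \<in> int_vectors_star \<eta> d" and "\<eta> > 0"
    and summable: "summable (\<lambda>n. norm (M n) * exp (enn2real (eta_norm \<eta> m)) ^ n)"
    and has_sum: "\<And>\<theta>. ((\<lambda>n. \<chi> i j. cis ((real n - 1/2) * \<theta>) * M n $ i $ j) has_sum U \<theta>) UNIV"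
    and det: "\<And>\<theta>. det (U \<theta>) = 1"
  shows "(\<lambda>x. U (pairing m x)) \<in> analytic_SL2 \<eta> d"
proof -
  define g where "g n = (\<lambda>j. (2 * int n - 1) * m j)" for n
  define t where "t = enn2real (eta_norm \<eta> m)"
  have t: "t > 0" using int_vectors_starD[OF m \<open>\<eta> > 0\<close>] by (simp add: t_def)
  have odd_nz: "2 * int n - 1 \<noteq> 0" for n by presburger
  obtain j0 where j0: "m j0 \<noteq> 0" using int_vectors_starD[OF m \<open>\<eta> > 0\<close>] by blast
  have inj: "inj g"
  proof (rule injI)
    fix a b assume "g a = g b"
    then have "(2 * int a - 1) * m j0 = (2 * int b - 1) * m j0" unfolding g_def by (rule fun_cong)
    then show "a = b" using j0 by simp
  qed
  have range: "range g \<subseteq> fin_int_vectors d"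
    using int_vectors_starD(1)[OF m \<open>\<eta> > 0\<close>]
    by (auto simp: g_def fin_int_vectors_def int_vectors_def elim: rev_finite_subset)
  define N where "N k = (if k \<in> range g then M (inv g k) else 0)" for k
  have N_g: "N (g n) = M n" for n using inj by (simp add: N_def)
  have eta_g: "enn2real (eta_norm \<eta> (g n)) = \<bar>2 * real n - 1\<bar> * t" for n
    by (simp add: g_def eta_norm_scale enn2real_mult t_def)
  have "(\<lambda>k. norm (N k) * exp (1 * enn2real (eta_norm \<eta> k) / 2)) summable_on fin_int_vectors d"
  proof -
    have "summable (\<lambda>n. norm (norm (N (g n)) * exp (1 * enn2real (eta_norm \<eta> (g n)) / 2)))"
    proof (rule summable_comparison_test')
      show "summable (\<lambda>n. exp (t/2) * (norm (M n) * exp t ^ n))"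
        using summable unfolding t_def by (rule summable_mult)
      fix n :: nat assume "n \<ge> 0"
      \<comment> \<open>The bound \<open>2 * n + 1\<close> also covers \<open>n = 0\<close>, whose
        frequency vector is \<open>- m\<close>; the price is the constant
        \<open>exp (t/2)\<close>.\<close>
      have "\<bar>2 * real n - 1\<bar> * t / 2 \<le> (2 * real n + 1) * t / 2"
        using t by (intro divide_right_mono mult_right_mono) auto
      also have "\<dots> = t / 2 + real n * t" by (simp add: field_simps)
      finally have "exp (\<bar>2 * real n - 1\<bar> * t / 2) \<le> exp (t/2) * exp t ^ n"
        by (simp add: exp_of_nat_mult[symmetric] exp_add[symmetric])
      then have "norm (M n) * exp (\<bar>2 * real n - 1\<bar> * t / 2) \<le> norm (M n) * (exp (t/2) * exp t ^ n)"
        by (rule mult_left_mono) simp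
      then show "norm (norm (norm (N (g n)) * exp (1 * enn2real (eta_norm \<eta> (g n)) / 2)))
          \<le> exp (t/2) * (norm (M n) * exp t ^ n)"
        by (simp add: N_g eta_g mult.left_commute)
    qed
    then have "(\<lambda>n. norm (N (g n)) * exp (1 * enn2real (eta_norm \<eta> (g n)) / 2)) summable_on UNIV"
      by (rule norm_summable_imp_summable_on)
    then have "(\<lambda>k. norm (N k) * exp (1 * enn2real (eta_norm \<eta> k) / 2)) summable_on range g"
      using summable_on_reindex[OF inj, of "\<lambda>k. norm (N k) * exp (1 * enn2real (eta_norm \<eta> k) / 2)"]
      by (simp add: o_def)
    then show ?thesis
      by (rule summable_on_cong_neutral[THEN iffD1, rotated 3]) (use range in \<open>auto simp: N_def\<close>)
  qed
  moreover have "((\<lambda>k. \<chi> i j. cis (pairing k x / 2) * N k $ i $ j) has_sum U (pairing m x)) (fin_int_vectors d)" for x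
  proof -
    have "pairing (g n) x / 2 = (real n - 1/2) * pairing m x" for n
      unfolding g_def pairing_scale[OF odd_nz] by (simp add: field_simps)
    then have "((\<lambda>k. \<chi> i j. cis (pairing k x / 2) * N k $ i $ j) has_sum U (pairing m x)) (range g)"
      unfolding has_sum_reindex[OF inj] o_def N_g using has_sum by simp
    then show ?thesis
      by (rule has_sum_cong_neutral[THEN iffD1, rotated 3])
         (use range in \<open>auto simp: N_def vec_eq_iff\<close>)
  qed
  ultimately show ?thesis
    unfolding analytic_SL2_def using det by (auto intro!: exI[of _ N] exI[of _ "1::real"])
qed

text \<open>Absolute convergence on the circle of radius \<open>R\<close>. With \<open>R\<close> the
  exponential of the \<eta>-norm of \<open>m\<close>, it controls the weight in
  \<open>analytic_SL2\<close> for \<open>h = 1\<close> up to a constant.\<close>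

definition weighted_summable :: "real \<Rightarrow> complex fps \<Rightarrow> bool" where
  "weighted_summable R F \<longleftrightarrow> summable (\<lambda>n. norm (fps_nth F n) * R ^ n)"

lemma weighted_summable_twist [simp]: "weighted_summable R (twist \<omega> F) \<longleftrightarrow> weighted_summable R F"
  by (simp add: weighted_summable_def norm_mult)

lemma weighted_summable_const_mult:
  "weighted_summable R F \<Longrightarrow> weighted_summable R (fps_const c * F)"
  unfolding weighted_summable_def using summable_mult[of _ "norm c"] by (simp add: norm_mult mult.assoc)

lemma weighted_summable_diff:
  assumes "weighted_summable R F" and "weighted_summable R G" and "R > 0"
  shows "weighted_summable R (F - G)"
  unfolding weighted_summable_def
proof (rule summable_comparison_test')
  show "summable (\<lambda>n. norm (fps_nth F n) * R ^ n + norm (fps_nth G n) * R ^ n)"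
    using assms(1,2) unfolding weighted_summable_def by (rule summable_add)
  show "norm (norm (fps_nth (F - G) n) * R ^ n) \<le> norm (fps_nth F n) * R ^ n + norm (fps_nth G n) * R ^ n" for n
    using assms(3) mult_right_mono[OF norm_triangle_ineq4[of "fps_nth F n" "fps_nth G n"], of "R ^ n"]
    by (simp add: distrib_right)
qed

lemma weighted_summable_conv_radius:
  assumes "weighted_summable R F" and "R > 1"
  shows "fps_conv_radius F > 1"
proof -
  have "summable (\<lambda>n. fps_nth F n * of_real R ^ n)"
    using assms unfolding weighted_summable_def
    by - (rule summable_norm_cancel, simp add: norm_mult norm_power)
  from conv_radius_geI[OF this] have "ereal R \<le> fps_conv_radius F"
    using assms(2) by (simp add: fps_conv_radius_def)
  moreover have "1 < ereal R" using assms(2) by (simp add: one_ereal_def)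
  ultimately show ?thesis by (rule less_le_trans[rotated])
qed

lemma eval_fps_times_phase_has_sum:
  assumes "fps_conv_radius F > 1"
  shows "((\<lambda>n. cis ((real n - 1/2) * \<theta>) * fps_nth F n) has_sum cis (- \<theta>/2) * eval_fps F (cis \<theta>)) UNIV"
proof -
  have conv: "norm (cis \<theta>) < fps_conv_radius F" using assms by (simp add: one_ereal_def)
  have eq: "cis (- \<theta>/2) * (fps_nth F n * cis \<theta> ^ n) = cis ((real n - 1/2) * \<theta>) * fps_nth F n" for n
  proof -
    have "cis (- \<theta>/2) * cis \<theta> ^ n = cis ((real n - 1/2) * \<theta>)"
      by (simp add: Complex.DeMoivre cis_mult left_diff_distrib)
    then show ?thesis by (metis mult.assoc mult.commute)
  qed
  show ?thesis
  proof (rule norm_summable_imp_has_sum)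
    show "summable (\<lambda>n. norm (cis ((real n - 1/2) * \<theta>) * fps_nth F n))"
      using norm_summable_fps[OF conv] by (simp add: norm_mult norm_power)
    show "(\<lambda>n. cis ((real n - 1/2) * \<theta>) * fps_nth F n) sums (cis (- \<theta>/2) * eval_fps F (cis \<theta>))"
      using sums_mult[OF sums_eval_fps[OF conv], of "cis (- \<theta>/2)"] by (simp only: eq)
  qed
qed

text \<open>The transfer matrix acts on
  \<open>(\<psi>(\<theta>), \<psi>(\<theta> - \<omega>))\<close>, hence the backward shifts in the
  second row. One step back undoes a Jordan block, so the last entry subtracts the Jordan entry
  times the first solution.\<close>

definition solution_coeff_matrix :: "real \<Rightarrow> real \<Rightarrow> nat \<Rightarrow> complex^2^2" where
  "solution_coeff_matrix \<omega> \<mu> n =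
    (let F = bloch_solution \<omega> \<mu>; G = generalized_solution \<omega> \<mu> in
     vector [vector [fps_nth F n, fps_nth G n],
       vector [fps_nth (twist (- \<omega>) F) n,
               fps_nth (twist (- \<omega>) (G - fps_const (of_real (jordan_entry \<omega> \<mu>)) * F)) n]])"

definition solution_matrix :: "real \<Rightarrow> real \<Rightarrow> real \<Rightarrow> complex^2^2" where
  "solution_matrix \<omega> \<mu> \<theta> =
    (let F = bloch_solution \<omega> \<mu>; G = generalized_solution \<omega> \<mu>;
         ev = (\<lambda>H. cis (- \<theta>/2) * eval_fps H (cis \<theta>)) in
     vector [vector [ev F, ev G],
       vector [ev (twist (- \<omega>) F),
               ev (twist (- \<omega>) (G - fps_const (of_real (jordan_entry \<omega> \<mu>)) * F))]])"

section \<open>Determinant and conjugacy of the solution matrix\<close>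

context
  fixes \<omega> \<mu> R :: real
  assumes nonres: "\<And>n. n \<ge> 1 \<Longrightarrow> sin (real n * \<omega> / 2) \<noteq> 0"
    and R: "R > 1"
    and wsF: "weighted_summable R (bloch_solution \<omega> \<mu>)"
    and wsG: "weighted_summable R (generalized_solution \<omega> \<mu>)"
begin

private abbreviation "F \<equiv> bloch_solution \<omega> \<mu>"
private abbreviation "G \<equiv> generalized_solution \<omega> \<mu>"
private abbreviation "Z \<equiv> fps_const (complex_of_real (jordan_entry \<omega> \<mu>))"
private abbreviation "F1 \<equiv> twist (- \<omega>) F"
private abbreviation "Q \<equiv> twist (- \<omega>) (G - Z * F)"

private lemma ws: "weighted_summable R F1" "weighted_summable R (Z * F)" "weighted_summable R (G - Z * F)"
   "weighted_summable R Q"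
  using R wsF wsG by (simp_all add: weighted_summable_diff weighted_summable_const_mult)

private lemma conv: "fps_conv_radius F > 1" "fps_conv_radius G > 1" "fps_conv_radius F1 > 1"
   "fps_conv_radius Q > 1" "fps_conv_radius (Z * F) > 1" "fps_conv_radius (G - Z * F) > 1"
   "fps_conv_radius (twist \<omega> F) > 1" "fps_conv_radius (twist \<omega> G) > 1"
   "fps_conv_radius (Z * twist \<omega> F) > 1"
  using R wsF wsG ws
  by (auto intro!: weighted_summable_conv_radius[OF _ R] weighted_summable_const_mult)

lemma solution_matrix_has_sum:
  "((\<lambda>n. \<chi> i j. cis ((real n - 1/2) * \<theta>) * solution_coeff_matrix \<omega> \<mu> n $ i $ j)
     has_sum solution_matrix \<omega> \<mu> \<theta>) UNIV"
proof (intro vec_has_sumI)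
  fix i j :: 2
  show "((\<lambda>n. (\<chi> i j. cis ((real n - 1/2) * \<theta>) * solution_coeff_matrix \<omega> \<mu> n $ i $ j) $ i $ j)
     has_sum solution_matrix \<omega> \<mu> \<theta> $ i $ j) UNIV"
    using exhaust_2[of i] exhaust_2[of j] conv[THEN eval_fps_times_phase_has_sum, of \<theta>]
    by (auto simp del: twist_nth fps_sub_nth simp: solution_matrix_def solution_coeff_matrix_def Let_def)
qed

lemma solution_coeff_matrix_summable:
  "summable (\<lambda>n. norm (solution_coeff_matrix \<omega> \<mu> n) * R ^ n)"
proof (rule summable_comparison_test')
  let ?s = "\<lambda>H n. norm (fps_nth H n) * R ^ n"
  show "summable (\<lambda>n. ?s F n + ?s G n + (?s F1 n + ?s Q n))"
    using wsF wsG ws by (intro summable_add) (simp_all only: weighted_summable_def)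
  fix n
  have "norm (solution_coeff_matrix \<omega> \<mu> n) \<le> (\<Sum>i\<in>UNIV. \<Sum>j\<in>UNIV. norm (solution_coeff_matrix \<omega> \<mu> n $ i $ j))"
    by (rule order.trans[OF norm_vec_le_sum]) (intro sum_mono norm_vec_le_sum)
  also have "\<dots> = norm (fps_nth F n) + norm (fps_nth G n) + (norm (fps_nth F1 n) + norm (fps_nth Q n))"
    by (simp del: twist_nth fps_sub_nth add: sum_2 solution_coeff_matrix_def Let_def)
  finally have "norm (solution_coeff_matrix \<omega> \<mu> n) * R ^ n
      \<le> (norm (fps_nth F n) + norm (fps_nth G n) + (norm (fps_nth F1 n) + norm (fps_nth Q n))) * R ^ n"
    using R by (intro mult_right_mono) auto
  then show "norm (norm (solution_coeff_matrix \<omega> \<mu> n) * R ^ n) \<le> ?s F n + ?s G n + (?s F1 n + ?s Q n)"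
    using R by (simp only: distrib_right) simp
qed

text \<open>The Wronskian series evaluates to \<open>z\<close>, and the phases of the two columns
  multiply to its inverse.\<close>

lemma det_solution_matrix: "det (solution_matrix \<omega> \<mu> \<theta>) = 1"
proof -
  define z where "z = cis \<theta>"
  have n: "norm z < fps_conv_radius H" if "fps_conv_radius H > 1" for H :: "complex fps"
    using that by (simp add: z_def one_ereal_def)
  have m: "fps_conv_radius (H * H') > 1" if "fps_conv_radius H > 1" "fps_conv_radius H' > 1" for H H' :: "complex fps"
    using that by (intro less_le_trans[OF _ fps_conv_radius_mult]) simp
  have "eval_fps F z * eval_fps Q z - eval_fps F1 z * eval_fps G z = eval_fps (F * Q - F1 * G) z"
    by (simp only: eval_fps_diff[OF n[OF m[OF conv(1,4)]] n[OF m[OF conv(3,2)]]]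
      eval_fps_mult[OF n[OF conv(1)] n[OF conv(4)]] eval_fps_mult[OF n[OF conv(3)] n[OF conv(2)]])
  also have "\<dots> = z" by (simp only: solution_wronskian[OF nonres] eval_fps_X)
  finally have w: "eval_fps F z * eval_fps Q z - eval_fps F1 z * eval_fps G z = z" .
  have "det (solution_matrix \<omega> \<mu> \<theta>) = (cis (- \<theta>/2) * cis (- \<theta>/2)) *
      (eval_fps F z * eval_fps Q z - eval_fps F1 z * eval_fps G z)"
    by (simp add: det_2 solution_matrix_def Let_def z_def algebra_simps)
  then show ?thesis unfolding w by (simp add: z_def cis_mult)
qed

text \<open>The first row consists of the two shift identities evaluated at
  \<open>cis \<theta>\<close>. In the second row the forward shift undoes the backward one and the
  \<zeta> terms cancel.\<close>

lemma solution_matrix_shift: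
  "vector [vector [complex_of_real (2 * cos (\<omega>/2)) - of_real \<mu> * cis \<theta>, -1], vector [1, 0]] ** solution_matrix \<omega> \<mu> \<theta>
     = solution_matrix \<omega> \<mu> (\<theta> + \<omega>) ** vector [vector [1, of_real (jordan_entry \<omega> \<mu>)], vector [0, 1]]"
proof -
  define z where "z = cis \<theta>"
  define \<zeta> where "\<zeta> = complex_of_real (jordan_entry \<omega> \<mu>)"
  define l where "l = complex_of_real (2 * cos (\<omega>/2)) - of_real \<mu> * z"
  define L where "L = fps_const (complex_of_real (2 * cos (\<omega>/2))) - fps_const (of_real \<mu>) * fps_X"
  have n: "norm z < fps_conv_radius H" if "fps_conv_radius H > 1" for H :: "complex fps"
    using that by (simp add: z_def one_ereal_def)
  have m: "fps_conv_radius (H * H') > 1" if "fps_conv_radius H > 1" "fps_conv_radius H' > 1" for H H' :: "complex fps"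
    using that by (intro less_le_trans[OF _ fps_conv_radius_mult]) simp
  have s: "fps_conv_radius (H - H') > 1" if "fps_conv_radius H > 1" "fps_conv_radius H' > 1" for H H' :: "complex fps"
    using that by (intro less_le_trans[OF _ fps_conv_radius_diff]) simp
  have L: "L = fps_of_poly [:complex_of_real (2 * cos (\<omega>/2)), - of_real \<mu>:]"
    by (simp add: L_def fps_of_poly_pCons mult.commute)
  have cL: "fps_conv_radius L > 1" by (simp add: L)
  have eL: "eval_fps L z = l" by (simp add: L l_def mult.commute)
  have eZ: "eval_fps (Z * H) z = \<zeta> * eval_fps H z" if "fps_conv_radius H > 1" for H
    using n[OF that] by (subst eval_fps_mult) (auto simp: \<zeta>_def)
  have 1: "eval_fps (twist \<omega> F) z = l * eval_fps F z - eval_fps F1 z"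
    by (simp only: twist_bloch_solution[OF nonres, of \<mu>, folded L_def] eL
      eval_fps_diff[OF n[OF m[OF cL conv(1)]] n[OF conv(3)]] eval_fps_mult[OF n[OF cL] n[OF conv(1)]])
  have 2: "eval_fps (twist \<omega> G) z = l * eval_fps G z - eval_fps Q z - \<zeta> * eval_fps (twist \<omega> F) z"
    by (simp only: twist_generalized_solution[OF nonres, of \<mu>, folded L_def] eL
      eval_fps_diff[OF n[OF s[OF m[OF cL conv(2)] conv(4)]] n[OF conv(9)]]
      eval_fps_diff[OF n[OF m[OF cL conv(2)]] n[OF conv(4)]] eval_fps_mult[OF n[OF cL] n[OF conv(2)]]
      eZ[OF conv(7)])
  have 3: "eval_fps (G - Z * F) z = eval_fps G z - \<zeta> * eval_fps F z"
    by (simp only: eval_fps_diff[OF n[OF conv(2)] n[OF conv(5)]] eZ[OF conv(1)])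
  have tw: "cis (- (\<theta> + \<omega>)/2) * eval_fps H (cis (\<theta> + \<omega>)) = cis (- \<theta>/2) * eval_fps (twist \<omega> H) z"
    if "fps_conv_radius H > 1" for H
  proof -
    have "cis (- (\<theta> + \<omega>)/2) = cis (- \<theta>/2) * cis (- \<omega>/2)" "cis (\<theta> + \<omega>) = cis \<omega> * z"
      unfolding z_def cis_mult by (rule arg_cong[of _ _ cis], simp add: field_simps)+
    then show ?thesis by (simp only: eval_fps_twist[OF n[OF that]] mult.assoc)
  qed
  have shift: "solution_matrix \<omega> \<mu> (\<theta> + \<omega>) = vector [vector [cis (- \<theta>/2) * eval_fps (twist \<omega> F) z,
      cis (- \<theta>/2) * eval_fps (twist \<omega> G) z],
      vector [cis (- \<theta>/2) * eval_fps F z, cis (- \<theta>/2) * eval_fps (G - Z * F) z]]"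
    unfolding solution_matrix_def Let_def tw[OF conv(1)] tw[OF conv(2)] tw[OF conv(3)] tw[OF conv(4)] twist_twist_minus ..
  show ?thesis unfolding shift 3 2 unfolding 1 unfolding l_def z_def \<zeta>_def
    by (simp add: solution_matrix_def Let_def vec_eq_iff forall_2 matrix_matrix_mult_def sum_2 algebra_simps)
qed

end

theorem theorem1p6:
  fixes d :: enat and \<eta> \<tau> :: real and \<alpha> :: "nat \<Rightarrow> real" and m :: "nat \<Rightarrow> int"
    and v :: "(nat \<Rightarrow> real) \<Rightarrow> complex"
  assumes "\<eta> > 0" and "\<tau> > 1" and "d \<ge> 1"
    and "\<alpha> \<in> DC \<eta> \<tau> d"
    and "m \<in> int_vectors_star \<eta> d"
    and "v = (\<lambda>x. cis (pairing m x))"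
  shows "\<exists>E\<in>{-2<..<2::real}. \<exists>\<epsilon>>0. \<forall>\<mu>::real. \<mu> \<noteq> 0 \<and> \<bar>\<mu>\<bar> < \<epsilon> \<longrightarrow>
           (\<exists>\<zeta>::complex. \<zeta> \<noteq> 0 \<and>
              reducible_to \<eta> d \<alpha> (schroedinger E \<mu> v) (vector [vector [1, \<zeta>], vector [0, 1]]))"
proof -
  define \<omega> where "\<omega> = pairing m \<alpha>"
  define D where "D n = \<bar>2 * sin (real n * \<omega> / 2)\<bar>" for n :: nat
  define R where "R = exp (enn2real (eta_norm \<eta> m))"
  have R: "R > 1" unfolding R_def using int_vectors_starD(3)[OF assms(5,1)] by simp
  obtain c s where cs: "c > 0" "s > 0" "\<And>n. n \<ge> 1 \<Longrightarrow> c / real n powr s \<le> D n"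
    using DC_multiples[OF assms(4,5,1,2)] unfolding D_def \<omega>_def by blast
  have nonres: "sin (real n * \<omega> / 2) \<noteq> 0" if "n \<ge> 1" for n
  proof
    assume "sin (real n * \<omega> / 2) = 0"
    then have "c / real n powr s \<le> 0" using cs(3)[OF that] by (simp add: D_def)
    moreover have "c / real n powr s > 0" using cs(1) that by simp
    ultimately show False by linarith
  qed
  have "D (i - j) \<le> D i + D j" if "j < i" for i j
    using abs_sin_subadditive[of "real i * \<omega> / 2" "real j * \<omega> / 2"] that
    by (simp add: D_def of_nat_diff left_diff_distrib diff_divide_distrib)
  then obtain K0 where K0: "K0 \<ge> 1" "\<And>k. 1 / K0 ^ k \<le> (\<Prod>j=1..k. D j)"
    using prod_small_divisors_ge[OF cs] by blast
  define K where "K = 2 * K0\<^sup>2"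
  have "1 * 1 \<le> 2 * K0\<^sup>2" using K0(1) by (intro mult_mono one_le_power) auto
  then have K: "K \<ge> 1" by (simp add: K_def)
  have prod: "1 / K ^ n \<le> (\<Prod>j=2..n. \<bar>bloch_divisor \<omega> j\<bar>)" for n
    unfolding K_def using bloch_divisor_prod_ge[OF K0(1) K0(2)[unfolded D_def]] .
  \<comment> \<open>The coefficient rate \<open>8 * K\<^sup>2 * \<bar>\<mu>\<bar>\<close> times the
    weight \<open>R\<close> has to be below 1. This threshold, like the energy, is fixed before
    \<mu>.\<close>
  define \<epsilon> where "\<epsilon> = 1 / (8 * K\<^sup>2 * R)"
  have red: "reducible_to \<eta> d \<alpha> (schroedinger (2 * cos (\<omega>/2)) \<mu> v)
       (vector [vector [1, of_real (jordan_entry \<omega> \<mu>)], vector [0, 1]])"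
    if \<mu>: "\<mu> \<noteq> 0" "\<bar>\<mu>\<bar> < \<epsilon>" for \<mu>
  proof -
    obtain C where C: "norm (fps_nth (bloch_solution \<omega> \<mu>) n) \<le> C * (8 * K\<^sup>2 * \<bar>\<mu>\<bar>) ^ n"
      "norm (fps_nth (generalized_solution \<omega> \<mu>) n) \<le> C * (8 * K\<^sup>2 * \<bar>\<mu>\<bar>) ^ n" for n
      using solution_coeff_bounds[OF K prod \<mu>(1)] by blast
    define r where "r = 8 * K\<^sup>2 * \<bar>\<mu>\<bar>"
    have r: "r \<ge> 0" "r * R < 1"
      using \<mu>(2) K R by (simp_all add: r_def \<epsilon>_def field_simps)
    have ws: "weighted_summable R H" if H: "\<And>n. norm (fps_nth H n) \<le> C * r ^ n" for H
      unfolding weighted_summable_def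
    proof (rule summable_comparison_test')
      show "summable (\<lambda>n. C * (r * R) ^ n)" using r R by (intro summable_mult summable_geometric) auto
      show "norm (norm (fps_nth H n) * R ^ n) \<le> C * (r * R) ^ n" for n
        using mult_right_mono[OF H[of n], of "R ^ n"] R by (simp add: power_mult_distrib mult.assoc)
    qed
    note sol = nonres R ws[OF C(1)[folded r_def]] ws[OF C(2)[folded r_def]]
    define B where "B x = solution_matrix \<omega> \<mu> (pairing m x)" for x
    have "B \<in> analytic_SL2 \<eta> d"
      unfolding B_def using solution_coeff_matrix_summable[OF sol, unfolded R_def]
        solution_matrix_has_sum[OF sol] det_solution_matrix[OF sol]
      by (rule half_integer_series_in_analytic_SL2[OF assms(5,1)])
    moreover have "matrix_inv (B (\<lambda>j. x j + \<alpha> j)) ** schroedinger (2 * cos (\<omega>/2)) \<mu> v x ** B x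
        = vector [vector [1, of_real (jordan_entry \<omega> \<mu>)], vector [0, 1]]" for x
    proof -
      have B': "B (\<lambda>j. x j + \<alpha> j) = solution_matrix \<omega> \<mu> (pairing m x + \<omega>)"
        by (simp add: B_def pairing_add \<omega>_def)
      have "schroedinger (2 * cos (\<omega>/2)) \<mu> v x ** B x = B (\<lambda>j. x j + \<alpha> j) **
          vector [vector [1, of_real (jordan_entry \<omega> \<mu>)], vector [0, 1]]"
        unfolding B' unfolding B_def schroedinger_def assms(6) by (rule solution_matrix_shift[OF sol])
      moreover have "matrix_inv (B (\<lambda>j. x j + \<alpha> j)) ** B (\<lambda>j. x j + \<alpha> j) = mat 1"
        unfolding B' by (rule matrix_inv_mult_self) (simp add: det_solution_matrix[OF sol])
      ultimately show ?thesis
        unfolding matrix_mul_assoc[symmetric] by (simp only: matrix_mul_assoc matrix_mul_lid)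
    qed
    ultimately show ?thesis unfolding reducible_to_def by (auto simp: det_2)
  qed
  \<comment> \<open>Nonresonance at \<open>n = 1\<close> keeps the energy strictly between -2 and 2
    and the Jordan entry away from 0.\<close>
  have sin0: "sin (\<omega>/2) \<noteq> 0" using nonres[of 1] by simp
  have "(cos (\<omega>/2))\<^sup>2 < 1\<^sup>2" using sin_cos_squared_add[of "\<omega>/2"] sin0
    by (simp only: power_one) (smt (verit) zero_less_power2)
  then have "\<bar>cos (\<omega>/2)\<bar> < 1" by (simp add: abs_square_less_1)
  then have "2 * cos (\<omega>/2) \<in> {-2<..<2}" by auto
  moreover have "\<epsilon> > 0" using K R by (simp add: \<epsilon>_def)
  moreover have "jordan_entry \<omega> \<mu> \<noteq> 0" if "\<mu> \<noteq> 0" for \<mu>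
    using that sin0 by (simp add: jordan_entry_def)
  ultimately show ?thesis using red by (metis of_real_eq_0_iff)
qed

end
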